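(* Let $n\ge 2$ and let $p(x)=x^n+a_{n-1}x^{n-1}+\dots+a_1x+a_0$ be a monic polynomial with complex coefficients and $a_0\neq 0$. Let $\lambda_1,\dots,\lambda_n$ be its complex roots, listed with multiplicity so that $|\lambda_1|\le|\lambda_2|\le\dots\le|\lambda_n|$. Let $C_1$ be the companion matrix of $p$ and $C_2$ the companion matrix of the monic reversal polynomial $q$ of $p$. Let $N_1$ and $N_2$ be any two (submultiplicative, not necessarily distinct) matrix norms on the $n\times n$ complex matrices. Then for all positive integers $k_1,k_2$, $$|\lambda_n|-|\lambda_1|\le N_1\left(C_1^{k_1}\right)^{1/k_1}-N_2\left(C_2^{k_2}\right)^{-1/k_2}$$ and $$\max_{i,j}|\lambda_j-\lambda_i|\le 2\,N_1\left(C_1^{k_1}\right)^{1/k_1}.$$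
   Context: A matrix norm is a norm $N$ on the space of $n\times n$ complex matrices which is submultiplicative: $N(AB)\le N(A)N(B)$. For a monic polynomial $f(x)=x^n+c_{n-1}x^{n-1}+\dots+c_0$, the companion matrix of $f$ is the $n\times n$ matrix with $1$'s on the first subdiagonal, last column $(-c_0,-c_1,\dots,-c_{n-1})^{T}$, and all other entries $0$. For $p(x)=x^n+a_{n-1}x^{n-1}+\dots+a_0$ with $a_0\ne0$, the monic reversal polynomial of $p$ is $q(x)=x^n+\frac{a_1}{a_0}x^{n-1}+\dots+\frac{a_{n-1}}{a_0}x+\frac{1}{a_0}$. *)

theory Defs
  imports
    Complex_Main
    "HOL-Computational_Algebra.Polynomial"
    "Jordan_Normal_Form.Matrix"
begin

(* Nothing is assumed about the values of N outside carrier_mat n n. *)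
definition matrix_norm :: "nat \<Rightarrow> (complex mat \<Rightarrow> real) \<Rightarrow> bool" where
  "matrix_norm n N \<longleftrightarrow>
     (\<forall>A \<in> carrier_mat n n. 0 \<le> N A) \<and>
     (\<forall>A \<in> carrier_mat n n. N A = 0 \<longleftrightarrow> A = 0\<^sub>m n n) \<and>
     (\<forall>c. \<forall>A \<in> carrier_mat n n. N (c \<cdot>\<^sub>m A) = cmod c * N A) \<and>
     (\<forall>A \<in> carrier_mat n n. \<forall>B \<in> carrier_mat n n. N (A + B) \<le> N A + N B) \<and>
     (\<forall>A \<in> carrier_mat n n. \<forall>B \<in> carrier_mat n n. N (A * B) \<le> N A * N B)"

(* Matrix indices start at 0, so the last column is j = degree f - 1.
   Meant for monic f of degree at least 1. *)
definition companion_matrix :: "'a :: comm_ring_1 poly \<Rightarrow> 'a mat" where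
  "companion_matrix f = mat (degree f) (degree f)
     (\<lambda>(i, j). if Suc j = degree f then - coeff f i
               else if i = Suc j then 1 else 0)"

(* Meant for f with nonzero constant coefficient; only then does reflect_poly f
   have the same degree as f. *)
definition monic_reversal :: "'a :: field poly \<Rightarrow> 'a poly" where
  "monic_reversal f = Polynomial.smult (inverse (coeff f 0)) (reflect_poly f)"

lemma coeff_monic_reversal:
  "i \<le> degree f \<Longrightarrow> coeff (monic_reversal f) i = coeff f (degree f - i) / coeff f 0"
  by (simp add: monic_reversal_def coeff_reflect_poly divide_inverse mult.commute)

lemma degree_monic_reversal:
  "coeff f 0 \<noteq> 0 \<Longrightarrow> degree (monic_reversal f) = degree f"
  by (simp add: monic_reversal_def)

end

theory Submission
  imports Defs
begin

text \<open>
  If \<open>f x = 0\<close> for a monic \<open>f\<close>, then \<open>(1, x, \<dots>, x\<^sup>n\<^sup>-\<^sup>1)\<close> is a left eigenvector of the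
  companion matrix \<open>C\<close> of \<open>f\<close> for the eigenvalue \<open>x\<close>. Stacking \<open>n\<close> copies of it gives a
  nonzero matrix \<open>V\<close> with \<open>V C\<^sup>k = x\<^sup>k V\<close>, so every submultiplicative norm satisfies
  \<open>\<bar>x\<bar>\<^sup>k \<le> N (C\<^sup>k)\<close>. The roots of the monic reversal are the inverses of the roots, which
  turns the same bound into a lower bound for the modulus of every root.
\<close>

lemma companion_matrix_carrier: "companion_matrix f \<in> carrier_mat (degree f) (degree f)"
  by (simp add: companion_matrix_def)

text \<open>Right multiplication by the companion matrix shifts each row
  \<open>(1, x, x^2, ...)\<close> one place to the left; the vacated last place receives minus the
  lower-order part of \<open>f\<close> at \<open>x\<close>, which is \<open>x ^ n\<close> because
  \<open>x\<close> is a root.\<close>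

lemma power_rows_mult_companion_matrix:
  fixes f :: "'a :: comm_ring_1 poly"
  assumes deg: "degree f = n" and monic: "lead_coeff f = 1" and root: "poly f x = 0"
  defines "V \<equiv> mat n n (\<lambda>(i, j). x ^ j)"
  shows "V * companion_matrix f = x \<cdot>\<^sub>m V"
proof (rule eq_matI)
  fix i j assume "i < dim_row (x \<cdot>\<^sub>m V)" "j < dim_col (x \<cdot>\<^sub>m V)"
  then have ij: "i < n" "j < n" by (auto simp: V_def)
  have entry: "(V * companion_matrix f) $$ (i, j) =
      (\<Sum>m = 0..<n. x ^ m * (if Suc j = n then - coeff f m else if m = Suc j then 1 else 0))"
    using ij by (simp add: V_def companion_matrix_def deg scalar_prod_def)
  also have "\<dots> = x ^ Suc j"
  proof (cases "Suc j = n")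
    case True
    \<comment> \<open>Last column: the root equation is solved for its leading term.\<close>
    have "0 = (\<Sum>m<Suc n. coeff f m * x ^ m)"
      using root by (simp add: poly_altdef deg lessThan_Suc_atMost)
    also have "\<dots> = (\<Sum>m = 0..<n. coeff f m * x ^ m) + x ^ n"
      using monic deg by (simp add: atLeast0LessThan)
    finally have "x ^ n = - (\<Sum>m = 0..<n. coeff f m * x ^ m)"
      by (simp add: eq_neg_iff_add_eq_0 add.commute)
    with True show ?thesis by (simp add: sum_negf mult.commute)
  next
    case False
    \<comment> \<open>The only nonzero summand sits at \<open>m = Suc j\<close>, which has to lie in
      the summation range.\<close>
    then have "Suc j < n" using ij by simp
    with False show ?thesis by (simp add: if_distrib[of "(*) _"] cong: if_cong)
  qed
  finally show "(V * companion_matrix f) $$ (i, j) = (x \<cdot>\<^sub>m V) $$ (i, j)"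
    using ij by (simp add: V_def)
qed (simp_all add: V_def companion_matrix_def deg)

lemma mult_pow_mat_left_eigen:
  fixes A V :: "'a :: comm_semiring_1 mat"
  assumes A: "A \<in> carrier_mat n n" and V: "V \<in> carrier_mat m n" and eigen: "V * A = x \<cdot>\<^sub>m V"
  shows "V * A ^\<^sub>m k = x ^ k \<cdot>\<^sub>m V"
proof (induction k)
  case 0
  have "1 \<cdot>\<^sub>m V = V" by (rule eq_matI) auto
  then show ?case using A V by simp
next
  case (Suc k)
  have "V * A ^\<^sub>m Suc k = V * A ^\<^sub>m k * A"
    using assoc_mult_mat[OF V pow_carrier_mat[OF A] A] by simp
  also have "\<dots> = x ^ k \<cdot>\<^sub>m (V * A)"
    using mult_smult_assoc_mat[OF V A] by (simp add: Suc)
  also have "\<dots> = x ^ Suc k \<cdot>\<^sub>m V"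
    unfolding eigen by (rule eq_matI) (auto simp: ac_simps)
  finally show ?case .
qed

text \<open>Since \<open>N\<close> is submultiplicative,
  \<open>cmod c * N V = N (V * B) \<le> N V * N B\<close>, and the positive factor
  \<open>N V\<close> cancels. \<open>N\<close> is controlled only on square matrices, hence a square
  \<open>V\<close> instead of a single row vector.\<close>

lemma matrix_norm_left_eigen:
  assumes norm: "matrix_norm n N" and B: "B \<in> carrier_mat n n" and V: "V \<in> carrier_mat n n"
    and "V \<noteq> 0\<^sub>m n n" and eigen: "V * B = c \<cdot>\<^sub>m V"
  shows "cmod c \<le> N B"
proof -
  have "0 < N V"
    using norm V \<open>V \<noteq> 0\<^sub>m n n\<close> unfolding matrix_norm_def by (simp add: order_less_le)
  moreover have "cmod c * N V \<le> N V * N B"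
    using norm B V eigen unfolding matrix_norm_def by metis
  ultimately show ?thesis by simp
qed

lemma root_norm_le_companion_matrix:
  assumes norm: "matrix_norm n N" and deg: "degree f = n" and monic: "lead_coeff f = 1"
    and "n > 0" and "k > 0" and root: "poly f x = 0"
  shows "cmod x \<le> N (companion_matrix f ^\<^sub>m k) powr (1 / real k)"
proof -
  let ?C = "companion_matrix f"
  define V where "V = mat n n (\<lambda>(i, j). x ^ j)"
  have C: "?C \<in> carrier_mat n n"
    using companion_matrix_carrier[of f] deg by simp
  have V: "V \<in> carrier_mat n n" by (simp add: V_def)
  \<comment> \<open>The first column consists of \<open>x ^ 0 = 1\<close>, so this also covers
    \<open>x = 0\<close>.\<close>
  have "V $$ (0, 0) \<noteq> 0\<^sub>m n n $$ (0, 0)" using \<open>n > 0\<close> by (simp add: V_def)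
  then have "V \<noteq> 0\<^sub>m n n" by metis
  moreover have "V * ?C ^\<^sub>m k = x ^ k \<cdot>\<^sub>m V"
    using mult_pow_mat_left_eigen[OF C V]
      power_rows_mult_companion_matrix[OF deg monic root] V_def by blast
  ultimately have "cmod x ^ k \<le> N (?C ^\<^sub>m k)"
    using matrix_norm_left_eigen[OF norm pow_carrier_mat[OF C] V] by (metis norm_power)
  then have "(cmod x ^ k) powr (1 / real k) \<le> N (?C ^\<^sub>m k) powr (1 / real k)"
    by (intro powr_mono2) auto
  \<comment> \<open>\<open>powr_realpow\<close> requires a positive base; for \<open>x = 0\<close>
    both sides are 0, as \<open>k > 0\<close>.\<close>
  moreover have "(cmod x ^ k) powr (1 / real k) = cmod x"
    using \<open>k > 0\<close> by (cases "x = 0") (simp_all add: powr_powr flip: powr_realpow)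
  ultimately show ?thesis by simp
qed

text \<open>The reflected polynomial at \<open>inverse x\<close> equals \<open>f\<close> at
  \<open>x\<close> divided by \<open>x ^ degree f\<close>.\<close>

lemma poly_monic_reversal_inverse:
  assumes "x \<noteq> 0" and "poly f x = 0"
  shows "poly (monic_reversal f) (inverse x) = 0"
  using assms by (simp add: monic_reversal_def poly_reflect_poly_nz)

lemma lead_coeff_monic_reversal:
  "coeff f 0 \<noteq> 0 \<Longrightarrow> lead_coeff (monic_reversal f) = 1"
  by (simp add: degree_monic_reversal coeff_monic_reversal)

theorem theorem5p1:
  fixes n :: nat and p :: "complex poly" and l :: "nat \<Rightarrow> complex"
    and N1 N2 :: "complex mat \<Rightarrow> real" and k1 k2 :: nat
  assumes "n \<ge> 2"
    and "degree p = n" and "lead_coeff p = 1" and "coeff p 0 \<noteq> 0"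
    and "image_mset l (mset_set {1..n}) = proots p"
    and "mono_on {1..n} (\<lambda>i. cmod (l i))"
    and "matrix_norm n N1" and "matrix_norm n N2"
    and "k1 > 0" and "k2 > 0"
  shows "cmod (l n) - cmod (l 1)
           \<le> N1 (companion_matrix p ^\<^sub>m k1) powr (1 / real k1)
             - N2 (companion_matrix (monic_reversal p) ^\<^sub>m k2) powr (- 1 / real k2)
       \<and> (MAX (i, j) \<in> {1..n} \<times> {1..n}. cmod (l j - l i))
           \<le> 2 * N1 (companion_matrix p ^\<^sub>m k1) powr (1 / real k1)"
proof -
  let ?R1 = "N1 (companion_matrix p ^\<^sub>m k1) powr (1 / real k1)"
  let ?b = "N2 (companion_matrix (monic_reversal p) ^\<^sub>m k2)"
  have "p \<noteq> 0" using assms(4) by auto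
  have root: "poly p (l i) = 0" if "i \<in> {1..n}" for i
  proof -
    have "l i \<in># image_mset l (mset_set {1..n})" using that by simp
    then show ?thesis using \<open>p \<noteq> 0\<close> unfolding assms(5) by simp
  qed
  have upper: "cmod (l i) \<le> ?R1" if "i \<in> {1..n}" for i
    using root_norm_le_companion_matrix[OF assms(7,2,3) _ assms(9) root[OF that]] assms(1) by simp
  have root1: "poly p (l 1) = 0" using root assms(1) by simp
  have "l 1 \<noteq> 0"
    using root1 assms(4) by (metis poly_0_coeff_0)
  have "cmod (inverse (l 1)) \<le> ?b powr (1 / real k2)"
    using root_norm_le_companion_matrix[OF assms(8) _ lead_coeff_monic_reversal[OF assms(4)]
        _ assms(10) poly_monic_reversal_inverse[OF \<open>l 1 \<noteq> 0\<close> root1]]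
      degree_monic_reversal[OF assms(4)] assms(1,2) by simp
  \<comment> \<open>Inverting reverses the inequality because its smaller side is positive,
    \<open>l 1\<close> being nonzero.\<close>
  then have "inverse (?b powr (1 / real k2)) \<le> cmod (l 1)"
    using \<open>l 1 \<noteq> 0\<close> by (metis inverse_inverse_eq le_imp_inverse_le norm_inverse
        inverse_nonzero_iff_nonzero zero_less_norm_iff)
  then have lower: "?b powr (- 1 / real k2) \<le> cmod (l 1)"
    by (simp add: powr_minus)
  have "cmod (l j - l i) \<le> 2 * ?R1" if "i \<in> {1..n}" "j \<in> {1..n}" for i j
    using upper[OF that(1)] upper[OF that(2)] norm_triangle_ineq4[of "l j" "l i"] by linarith
  then have "(MAX (i, j) \<in> {1..n} \<times> {1..n}. cmod (l j - l i)) \<le> 2 * ?R1"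
    using assms(1) by (subst Max_le_iff) auto
  moreover have "cmod (l n) \<le> ?R1" using upper assms(1) by simp
  ultimately show ?thesis using lower by linarith
qed

end
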